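(* Let $L,d,n\ge 1$ be integers, let $V>0$, let $\phi_{out}:\mathbb{R}\to\mathbb{R}$ be a Lipschitz-$1$ function, and let $\mathcal{F}_{L,V}=\phi_{out}\circ(\mathcal{F}_{0,V})^L$ be the class of $L$-layer ReLU networks defined in the context. For data $X^n=(X_1,\dots,X_n)$ with $X_i\in[-1,1]^d$, let $A=\{(f(X_1),\dots,f(X_n)): f\in\mathcal{F}_{L,V}\}\subset\mathbb{R}^n$. Let $\xi_1,\dots,\xi_n$ be i.i.d., either symmetric Bernoulli ($\pm1$ with probability $1/2$ each; Rademacher case) or Normal$(0,1)$ (Gaussian case with $\sigma=1$). Then, uniformly over such data $X^n$, the Rademacher and Gaussian complexities of $\mathcal{F}_{L,V}$ are not more than the complexity using $\psi_\lambda(z)=e^{\lambda z}$ at a suitable $\lambda>0$, which is not more than $V\sqrt{2n(L\log 2+\log(2d))}$; that is, $$E\Big[\sup_{a\in A}\Big(\sum_{i=1}^n\xi_i a_i\Big)_+\Big]\;\le\; C_{\psi_\lambda}(A)\;\le\; V\sqrt{2n\,(L\log 2+\log(2d))}.$$ This bound is independent of the number of units on each hidden layer.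
   Context: Here $(z)_+=\max\{z,0\}$ and logarithms are natural. For $A\subset\mathbb{R}^n$ and $\lambda>0$, $$C_{\psi_\lambda}(A)=\frac1\lambda\log E\Big[\sup_{a\in A}\exp\Big(\lambda\Big(\sum_{i=1}^n\xi_i a_i\Big)_+\Big)\Big].$$ Definition of the class: let $\mathcal{F}_{0,V}=\{Vx_1,\dots,Vx_d,-Vx_1,\dots,-Vx_d\}$ be the set of signed coordinate functions of $x=(x_1,\dots,x_d)\in[-1,1]^d$ scaled by $V$ (one coordinate may be locked at the value $1$ to provide offsets). With $\phi(z)=(z)_+$ and for a class $\mathcal{F}$ of real-valued functions on $[-1,1]^d$, let $$\mathcal{F}'=\mathrm{conv}\{\pm\phi\circ\mathcal{F}\}=\Big\{\sum_j c_j\,\phi(f_j(\cdot)) : f_j\in\mathcal{F},\ \sum_j|c_j|\le 1\Big\},$$ the class with one more layer. $(\mathcal{F}_{0,V})^L$ is obtained by applying the operation $(\cdot)'$ $L$ times starting from $\mathcal{F}_{0,V}$; there is no restriction on the number of units per layer past the input layer. Finally $\mathcal{F}_{L,V}=\phi_{out}\circ(\mathcal{F}_{0,V})^L=\{\phi_{out}(f(\cdot)): f\in(\mathcal{F}_{0,V})^L\}$, where $\phi_{out}$ is an optional Lipschitz-$1$ function on the output layer (the identity if no output nonlinearity is used).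
   Formalization: The output function is additionally assumed to satisfy φ_out(0)=0; without this the claim is false, e.g. for φ_out(z)=z+c with |c| large, since the zero network puts (c,…,c) in A. *)

theory Defs
  imports "HOL-Probability.Probability"
begin

definition pos_part :: "real \<Rightarrow> real"
  where "pos_part z = max z 0"


subsection \<open>Network classes\<close>

text \<open>Networks are total functions on \<open>real^'d\<close>. Every operation below is pointwise in the input,
  so evaluating at points of the cube \<open>[-1,1]^d\<close> gives the same values as networks defined on
  the cube only.\<close>

definition input_layer :: "real \<Rightarrow> (real^'d \<Rightarrow> real) set"
  where "input_layer V = (\<Union>j. {\<lambda>x. V * x $ j, \<lambda>x. - (V * x $ j)})"

text \<open>The number \<open>m\<close> of units is a bound variable here: the width is unrestricted.\<close>

definition next_layer :: "('x \<Rightarrow> real) set \<Rightarrow> ('x \<Rightarrow> real) set"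
  where "next_layer F =
    {(\<lambda>x. \<Sum>j<m. c j * pos_part (f j x)) | (m::nat) (c::nat \<Rightarrow> real) f.
       (\<forall>j<m. f j \<in> F) \<and> (\<Sum>j<m. \<bar>c j\<bar>) \<le> 1}"

definition network_class :: "(real \<Rightarrow> real) \<Rightarrow> nat \<Rightarrow> real \<Rightarrow> (real^'d \<Rightarrow> real) set"
  where "network_class phi_out L V = (\<lambda>f. phi_out \<circ> f) ` (next_layer ^^ L) (input_layer V)"

definition values_on_data :: "('x \<Rightarrow> real) set \<Rightarrow> ('n \<Rightarrow> 'x) \<Rightarrow> (real^'n) set"
  where "values_on_data F X = (\<lambda>f. \<chi> i. f (X i)) ` F"


subsection \<open>Complexities\<close>

text \<open>Suprema and expectations are formed in \<open>[0,\<infinity>]\<close>, so that neither boundedness of the set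
  nor integrability of the supremum has to be presupposed.\<close>

definition linear_form :: "('n::finite \<Rightarrow> 'a \<Rightarrow> real) \<Rightarrow> 'a \<Rightarrow> real^'n \<Rightarrow> real"
  where "linear_form \<xi> \<omega> a = (\<Sum>i\<in>UNIV. \<xi> i \<omega> * a $ i)"

definition complexity ::
    "'a measure \<Rightarrow> ('n::finite \<Rightarrow> 'a \<Rightarrow> real) \<Rightarrow> (real^'n) set \<Rightarrow> ennreal"
  where "complexity M \<xi> A = (\<integral>\<^sup>+\<omega>. (SUP a\<in>A. ennreal (pos_part (linear_form \<xi> \<omega> a))) \<partial>M)"

definition ext_ln :: "ennreal \<Rightarrow> ereal"
  where "ext_ln x = (if x = 0 then -\<infinity> else if x = \<infinity> then \<infinity> else ereal (ln (enn2real x)))"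

definition psi_complexity ::
    "real \<Rightarrow> 'a measure \<Rightarrow> ('n::finite \<Rightarrow> 'a \<Rightarrow> real) \<Rightarrow> (real^'n) set \<Rightarrow> ereal"
  where "psi_complexity lam M \<xi> A =
    ereal (1 / lam) *
    ext_ln (\<integral>\<^sup>+\<omega>. (SUP a\<in>A. ennreal (exp (lam * pos_part (linear_form \<xi> \<omega> a)))) \<partial>M)"

definition rademacher_variable :: "'a measure \<Rightarrow> ('a \<Rightarrow> real) \<Rightarrow> bool"
  where "rademacher_variable M Y \<longleftrightarrow> Y \<in> borel_measurable M \<and>
    measure M {\<omega> \<in> space M. Y \<omega> = 1} = 1 / 2 \<and> measure M {\<omega> \<in> space M. Y \<omega> = -1} = 1 / 2"

definition std_normal_variable :: "'a measure \<Rightarrow> ('a \<Rightarrow> real) \<Rightarrow> bool"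
  where "std_normal_variable M Y \<longleftrightarrow> distributed M lborel Y std_normal_density"

end

theory Submission
  imports Defs
begin

text \<open>For a symmetric subgaussian noise vector the exponential moment of the supremum can be followed
  through the network layer by layer. Composition with a 1-Lipschitz map fixing 0 does not increase it
  (Ledoux--Talagrand): flipping the sign of one noise coordinate preserves the law, so it is enough to
  compare, for a fixed noise, the sum over the two signs, and this is a convexity inequality. Passing to
  the symmetric convex hull costs a factor 2, because the supremum is attained up to sign at a generator.
  The input layer has \<open>2 d\<close> elements of squared length at most \<open>V\<^sup>2 n\<close>. Altogether the moment at \<open>\<lambda>\<close> is at
  most \<open>2^L * 2 d * exp (\<lambda>\<^sup>2 V\<^sup>2 n / 2)\<close>, and it remains to optimise \<open>\<lambda>\<close>.\<close>

section \<open>Convexity inequalities for the two-point comparison\<close>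

text \<open>The inner points \<open>s + e\<close> and \<open>t\<close> are convex combinations of
  \<open>s\<close> and \<open>t + e\<close> with complementary weights, so the weights add up to 1
  at each endpoint when the two convexity inequalities are summed.\<close>

lemma convex_increment_mono:
  fixes G :: "real \<Rightarrow> real"
  assumes "convex_on UNIV G" "s \<le> t" "0 \<le> e"
  shows "G (s + e) + G t \<le> G s + G (t + e)"
proof (cases "t + e = s")
  case True
  then have "t = s" "e = 0" using assms by auto
  then show ?thesis by simp
next
  case False
  define D where "D = t + e - s"
  define w where "w = e / D"
  have D: "D > 0" using assms False by (auto simp: D_def)
  have w: "0 \<le> w" "w \<le> 1" using D assms by (auto simp: w_def D_def)
  have wD: "w * D = e" using D by (simp add: w_def)
  have 1: "s + e = (1 - w) * s + w * (t + e)" "t = w * s + (1 - w) * (t + e)"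
    using wD by (auto simp: D_def algebra_simps)
  have "G (s + e) \<le> (1 - w) * G s + w * G (t + e)"
    using convex_onD[OF assms(1), of w s "t + e"] w 1(1) by simp
  moreover have "G t \<le> w * G s + (1 - w) * G (t + e)"
    using convex_onD[OF assms(1), of "1 - w" s "t + e"] w 1(2) by simp
  ultimately show ?thesis by (simp add: algebra_simps)
qed

text \<open>The intervals from \<open>y - r\<close> to \<open>y - q\<close> and from
  \<open>y + q\<close> to \<open>y + r\<close> have the same length \<open>r - q\<close>, and the
  increment of a convex function is larger on the right one.\<close>

lemma convex_symmetric_spread_mono:
  fixes G :: "real \<Rightarrow> real"
  assumes "convex_on UNIV G" "\<bar>q\<bar> \<le> r"
  shows "G (y + q) + G (y - q) \<le> G (y + r) + G (y - r)"
  using convex_increment_mono[OF assms(1), of "y - r" "y + q" "r - q"] assms(2)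
  by (simp add: algebra_simps)

text \<open>The core of the Ledoux--Talagrand contraction principle: the four terms on the right arise
  from the two sign choices at each of the two points.\<close>

lemma contraction_two_point:
  fixes G :: "real \<Rightarrow> real"
  assumes G: "convex_on UNIV G" "mono G"
    and pq: "\<bar>p\<bar> \<le> \<bar>p'\<bar>" "\<bar>q\<bar> \<le> \<bar>q'\<bar>" "\<bar>p - q\<bar> \<le> \<bar>p' - q'\<bar>"
    and R: "G (x + p') + G (y - q') \<le> R" "G (y + q') + G (x - p') \<le> R"
      "G (x + p') + G (x - p') \<le> R" "G (y + q') + G (y - q') \<le> R"
  shows "G (x + p) + G (y - q) \<le> R"
proof -
  note mono = monoD[OF G(2)]
  have spread: "G (z + u) + G (z - u) \<le> G (z + u') + G (z - u')" if "\<bar>u\<bar> \<le> \<bar>u'\<bar>" for z u u'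
    using convex_symmetric_spread_mono[OF G(1), of u "\<bar>u'\<bar>" z] that by (auto simp: abs_if split: if_splits)
  have inc: "G (s + e) + G t \<le> G s + G (t + d)" if "s \<le> t" "0 \<le> e" "e \<le> d" for s t e d
    using convex_increment_mono[OF G(1), of s t e] mono[of "t + e" "t + d"] that by linarith
  \<comment> \<open>In the first two cases one point dominates: monotonicity moves both signs to
    that point, and spreading them symmetrically finishes. Only the third case mixes the two
    points.\<close>
  consider "x + p \<le> y + q" | "y - q \<le> x - p" | "y + q \<le> x + p" "x - p \<le> y - q" by linarith
  then show ?thesis
  proof cases
    case 1
    then show ?thesis using mono[OF 1] spread[OF pq(2), of y] R(4) by linarith
  next
    case 2
    then show ?thesis using mono[OF 2] spread[OF pq(1), of x] R(3) by linarith
  next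
    case 3
    \<comment> \<open>For opposite signs of \<open>p'\<close> and \<open>q'\<close> both arguments
      grow under a suitable common sign choice. For equal signs one argument has to shrink.\<close>
    consider "p' \<ge> 0" "q' \<le> 0" | "p' \<le> 0" "q' \<ge> 0"
      | "0 \<le> q'" "q' \<le> p'" | "0 \<le> p'" "p' \<le> q'" | "q' \<le> 0" "p' \<le> q'" | "p' \<le> 0" "q' \<le> p'"
      by linarith
    then show ?thesis
    proof cases
      case 1
      then have "x + p \<le> x + p'" "y - q \<le> y - q'" using pq by linarith+
      then show ?thesis using mono[of "x + p" "x + p'"] mono[of "y - q" "y - q'"] R(1) by linarith
    next
      case 2
      then have "x + p \<le> x - p'" "y - q \<le> y + q'" using pq by linarith+
      then show ?thesis using mono[of "x + p" "x - p'"] mono[of "y - q" "y + q'"] R(2) by linarith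
    next
      case c: 3
      \<comment> \<open>The loss from \<open>y - q\<close> to \<open>y - q'\<close> is paid by the
        gain from \<open>x + p\<close> to \<open>x + p'\<close>: that step is at least as long by
        the bound on \<open>\<bar>p - q\<bar>\<close>, and it starts further right in the present
        case. The other three cases are mirror images.\<close>
      have "G (y - q' + (q' - q)) + G (x + p) \<le> G (y - q') + G (x + p + (p' - p))"
        by (rule inc) (use c 3 pq in linarith)+
      then show ?thesis using R(1) by (simp add: algebra_simps)
    next
      case c: 4
      have "G (x - p' + (p' + p)) + G (y - q) \<le> G (x - p') + G (y - q + (q' + q))"
        by (rule inc) (use c 3 pq in linarith)+
      then show ?thesis using R(2) by (simp add: algebra_simps)
    next
      case c: 5
      have "G (y + q' + (- q - q')) + G (x + p) \<le> G (y + q') + G (x + p + (- p - p'))"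
        by (rule inc) (use c 3 pq in linarith)+
      then show ?thesis using R(2) by (simp add: algebra_simps)
    next
      case c: 6
      have "G (x + p' + (p - p')) + G (y - q) \<le> G (x + p') + G (y - q + (q - q'))"
        by (rule inc) (use c 3 pq in linarith)+
      then show ?thesis using R(1) by (simp add: algebra_simps)
    qed
  qed
qed

section \<open>Suprema of a gain function over linear forms, for a fixed noise\<close>

lemma SUP_add_SUP_le_ennreal:
  fixes f g :: "'t \<Rightarrow> ennreal"
  assumes "\<And>s t. s \<in> T \<Longrightarrow> t \<in> T \<Longrightarrow> f s + g t \<le> R"
  shows "(SUP t\<in>T. f t) + (SUP t\<in>T. g t) \<le> R"
proof (cases "T = {}")
  case False
  have "(SUP s\<in>T. f s) + (SUP t\<in>T. g t) = (SUP t\<in>T. SUP s\<in>T. f s + g t)"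
    by (simp add: ennreal_SUP_add_right[OF False] ennreal_SUP_add_left[OF False])
  also have "\<dots> \<le> R" using assms by (auto intro!: SUP_least)
  finally show ?thesis .
qed (simp add: bot_ennreal)

text \<open>The index set \<open>T\<close> is kept apart from the vectors \<open>v t\<close>, so
  that the vectors can be changed coordinate by coordinate while the index stays the same.\<close>

definition sup_gain :: "(real \<Rightarrow> real) \<Rightarrow> 't set \<Rightarrow> ('t \<Rightarrow> 'n \<Rightarrow> real) \<Rightarrow> ('n::finite \<Rightarrow> real) \<Rightarrow> ennreal"
  where "sup_gain G T v z = (SUP t\<in>T. ennreal (G (\<Sum>i\<in>UNIV. z i * v t i)))"

text \<open>\<open>T\<close> may be uncountable, so measurability comes from topology: a strict
  superlevel set of the supremum is a union of open sets. For a finite index type the product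
  sigma-algebra is the Borel one.\<close>

lemma sup_gain_measurable:
  fixes v :: "'t \<Rightarrow> 'n::finite \<Rightarrow> real"
  assumes G: "continuous_on UNIV G"
  shows "sup_gain G T v \<in> borel_measurable (Pi\<^sub>M UNIV (\<lambda>_. borel))"
proof (rule borel_measurableI_greater)
  fix y :: ennreal
  have "continuous_on UNIV (\<lambda>z::'n \<Rightarrow> real. ennreal (G (\<Sum>i\<in>UNIV. z i * v t i)))" for t
    by (rule continuous_on_ennreal, rule continuous_on_compose2[OF G])
      (auto intro!: continuous_intros)
  then have "open {z::'n \<Rightarrow> real. y < ennreal (G (\<Sum>i\<in>UNIV. z i * v t i))}" for t
    by (intro open_Collect_less continuous_intros)
  then have "open (\<Union>t\<in>T. {z::'n \<Rightarrow> real. y < ennreal (G (\<Sum>i\<in>UNIV. z i * v t i))})" by blast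
  also have "(\<Union>t\<in>T. {z::'n \<Rightarrow> real. y < ennreal (G (\<Sum>i\<in>UNIV. z i * v t i))}) = {z. y < sup_gain G T v z}"
    by (auto simp: sup_gain_def less_SUP_iff)
  finally show "{z \<in> space (Pi\<^sub>M UNIV (\<lambda>_. borel)). y < sup_gain G T v z} \<in> sets (Pi\<^sub>M UNIV (\<lambda>_. borel))"
    by (simp add: sets_PiM_equal_borel space_PiM)
qed

text \<open>The suprema at \<open>z\<close> and at the flipped noise may be approached at different
  indices \<open>s\<close> and \<open>t\<close>. This is why a comparison of two points is required,
  with \<open>u s\<close> and \<open>u t\<close> as the contributions of the other
  coordinates.\<close>

lemma sup_gain_contraction_coordinate:
  fixes v :: "'t \<Rightarrow> 'n::finite \<Rightarrow> real" and z :: "'n \<Rightarrow> real"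
  assumes G: "convex_on UNIV G" "mono G" "\<And>x. 0 \<le> G x"
    and phi: "1-lipschitz_on UNIV phi" "phi 0 = 0"
    and w: "\<And>t i. w t i = (if i = k then phi (v t i) else v t i)"
  shows "sup_gain G T w z + sup_gain G T w (z(k := - z k))
    \<le> sup_gain G T v z + sup_gain G T v (z(k := - z k))"
proof -
  define u where "u t = (\<Sum>i\<in>UNIV - {k}. z i * v t i)" for t
  have split: "(\<Sum>i\<in>UNIV. h i) = (\<Sum>i\<in>UNIV - {k}. h i) + h k" for h :: "'n \<Rightarrow> real"
    by (subst sum.remove[of _ k]) auto
  have rest: "(\<Sum>i\<in>UNIV - {k}. h i) = u t" if "\<And>i. i \<noteq> k \<Longrightarrow> h i = z i * v t i" for h t
    unfolding u_def by (rule sum.cong) (use that in auto)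
  have sums: "(\<Sum>i\<in>UNIV. z i * v t i) = u t + z k * v t k"
    "(\<Sum>i\<in>UNIV. z i * w t i) = u t + z k * phi (v t k)"
    "(\<Sum>i\<in>UNIV. (z(k := - z k)) i * v t i) = u t - z k * v t k"
    "(\<Sum>i\<in>UNIV. (z(k := - z k)) i * w t i) = u t - z k * phi (v t k)" for t
    by (subst split, subst rest[of _ t], simp_all add: w)+
  have lip: "\<bar>phi a - phi b\<bar> \<le> \<bar>a - b\<bar>" for a b
    using lipschitz_onD[OF phi(1), of a b] by (simp add: dist_real_def)
  have lip0: "\<bar>phi a\<bar> \<le> \<bar>a\<bar>" for a using lip[of a 0] phi(2) by simp
  let ?R = "(SUP t\<in>T. ennreal (G (u t + z k * v t k))) + (SUP t\<in>T. ennreal (G (u t - z k * v t k)))"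
  have "ennreal (G (u s + z k * phi (v s k))) + ennreal (G (u t - z k * phi (v t k))) \<le> ?R"
    if st: "s \<in> T" "t \<in> T" for s t
  proof (cases "?R = \<top>")
    case False
    define R where "R = enn2real ?R"
    have R: "0 \<le> R" "?R = ennreal R"
      using False unfolding R_def by (simp_all only: ennreal_enn2real_if enn2real_nonneg if_False)
    \<comment> \<open>Taking \<open>a\<close> and \<open>b\<close> from \<open>s\<close> and
      \<open>t\<close> in all four ways gives the four bounds by \<open>R\<close> that the two-point
      inequality asks for.\<close>
    have *: "G (u a + z k * v a k) + G (u b - z k * v b k) \<le> R" if "a \<in> T" "b \<in> T" for a b
    proof -
      have "ennreal (G (u a + z k * v a k)) + ennreal (G (u b - z k * v b k)) \<le> ?R"
        by (intro add_mono SUP_upper2[OF that(1)] SUP_upper2[OF that(2)] order_refl)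
      then show ?thesis using R G(3) by (simp flip: ennreal_plus)
    qed
    have "G (u s + z k * phi (v s k)) + G (u t - z k * phi (v t k)) \<le> R"
    proof (rule contraction_two_point[OF G(1,2)])
      show "\<bar>z k * phi (v s k) - z k * phi (v t k)\<bar> \<le> \<bar>z k * v s k - z k * v t k\<bar>"
        using lip[of "v s k" "v t k"] by (simp add: abs_mult mult_left_mono flip: right_diff_distrib)
    qed (use * st lip0 in \<open>auto simp: abs_mult mult_left_mono\<close>)
    then show ?thesis using R G(3) by (simp flip: ennreal_plus)
  next
    case True
    show ?thesis unfolding True by (rule top_greatest)
  qed
  then show ?thesis unfolding sup_gain_def sums by (rule SUP_add_SUP_le_ennreal)
qed

section \<open>Sign invariance and contraction for random noise\<close>

text \<open>Both noise laws enter the bound only through these properties. Independence and symmetry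
  give invariance under sign flips; the moment bound, with variance proxy 1, controls the input
  layer.\<close>

locale symmetric_subgaussian_noise = prob_space M for M :: "'a measure" +
  fixes \<xi> :: "'n::finite \<Rightarrow> 'a \<Rightarrow> real"
  assumes indep: "indep_vars (\<lambda>_. borel) \<xi> UNIV"
    and symmetric: "distr M borel (\<lambda>\<omega>. - \<xi> i \<omega>) = distr M borel (\<xi> i)"
    and subgaussian: "(\<integral>\<^sup>+\<omega>. ennreal (exp (t * \<xi> i \<omega>)) \<partial>M) \<le> ennreal (exp (t\<^sup>2 / 2))"
begin

lemma noise_measurable [measurable]: "\<xi> i \<in> borel_measurable M"
  using indep by (auto simp: indep_vars_def)

lemma vector_measurable: "(\<lambda>\<omega> i. \<xi> i \<omega>) \<in> M \<rightarrow>\<^sub>M Pi\<^sub>M UNIV (\<lambda>_. borel)"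
  by (intro measurable_abs_UNIV noise_measurable)

lemma sup_gain_noise_measurable:
  fixes v :: "'t \<Rightarrow> 'n \<Rightarrow> real"
  assumes "continuous_on UNIV G"
  shows "(\<lambda>\<omega>. sup_gain G T v (\<lambda>i. \<xi> i \<omega>)) \<in> borel_measurable M"
  using measurable_compose[OF vector_measurable sup_gain_measurable[OF assms]] .

text \<open>By independence the joint law is the product of the marginals, and symmetry leaves each
  marginal unchanged. The set \<open>I\<close> is a singleton for the contraction and
  \<open>UNIV\<close> for the convex hull.\<close>

lemma nn_integral_sign_change:
  assumes H: "H \<in> borel_measurable (Pi\<^sub>M UNIV (\<lambda>_. borel))"
  shows "(\<integral>\<^sup>+\<omega>. H (\<lambda>i. if i \<in> I then - \<xi> i \<omega> else \<xi> i \<omega>) \<partial>M) = (\<integral>\<^sup>+\<omega>. H (\<lambda>i. \<xi> i \<omega>) \<partial>M)"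
proof -
  let ?\<eta> = "\<lambda>i \<omega>. if i \<in> I then - \<xi> i \<omega> else \<xi> i \<omega>"
  have "indep_vars (\<lambda>_. borel) ?\<eta> UNIV"
    using indep_vars_compose2[OF indep, of "\<lambda>i x. if i \<in> I then - x else x" "\<lambda>_. borel"] by simp
  moreover have eta [measurable]: "?\<eta> i \<in> borel_measurable M" for i by measurable
  ultimately have "distr M (Pi\<^sub>M UNIV (\<lambda>_. borel)) (\<lambda>\<omega> i. ?\<eta> i \<omega>) = Pi\<^sub>M UNIV (\<lambda>i. distr M borel (?\<eta> i))"
    using indep_vars_iff_distr_eq_PiM[where I = UNIV and M' = "\<lambda>_. borel" and X = ?\<eta>]
    by (simp add: restrict_UNIV)
  also have "(\<lambda>i. distr M borel (?\<eta> i)) = (\<lambda>i. distr M borel (\<xi> i))"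
  proof
    show "distr M borel (?\<eta> i) = distr M borel (\<xi> i)" for i
      by (cases "i \<in> I") (simp_all add: symmetric)
  qed
  also have "Pi\<^sub>M UNIV (\<lambda>i. distr M borel (\<xi> i)) = distr M (Pi\<^sub>M UNIV (\<lambda>_. borel)) (\<lambda>\<omega> i. \<xi> i \<omega>)"
    using indep_vars_iff_distr_eq_PiM[where I = UNIV and M' = "\<lambda>_. borel" and X = \<xi>] indep
    by (simp add: restrict_UNIV)
  finally have eq: "distr M (Pi\<^sub>M UNIV (\<lambda>_. borel)) (\<lambda>\<omega> i. ?\<eta> i \<omega>) =
    distr M (Pi\<^sub>M UNIV (\<lambda>_. borel)) (\<lambda>\<omega> i. \<xi> i \<omega>)" .
  have "(\<lambda>\<omega> i. ?\<eta> i \<omega>) \<in> M \<rightarrow>\<^sub>M Pi\<^sub>M UNIV (\<lambda>_. borel)"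
    by (intro measurable_abs_UNIV eta)
  then show ?thesis
    using nn_integral_distr[of "\<lambda>\<omega> i. ?\<eta> i \<omega>" M "Pi\<^sub>M UNIV (\<lambda>_. borel)" H]
      nn_integral_distr[OF vector_measurable, of H] eq H by simp
qed

definition expected_gain :: "(real \<Rightarrow> real) \<Rightarrow> 't set \<Rightarrow> ('t \<Rightarrow> 'n \<Rightarrow> real) \<Rightarrow> ennreal"
  where "expected_gain G T v = (\<integral>\<^sup>+\<omega>. sup_gain G T v (\<lambda>i. \<xi> i \<omega>) \<partial>M)"

text \<open>Twice the expectation is the integral of the gain at the noise plus the gain at the
  flipped noise, and these sums compare pointwise.\<close>

lemma expected_gain_contraction_coordinate:
  fixes v :: "'t \<Rightarrow> 'n \<Rightarrow> real"
  assumes G: "convex_on UNIV G" "mono G" "\<And>x. 0 \<le> G x"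
    and phi: "1-lipschitz_on UNIV phi" "phi 0 = 0"
    and w: "\<And>t i. w t i = (if i = k then phi (v t i) else v t i)"
  shows "expected_gain G T w \<le> expected_gain G T v"
proof -
  have cont: "continuous_on UNIV G" by (rule convex_on_continuous[OF open_UNIV G(1)])
  have flip_meas: "(\<lambda>\<omega>. (\<lambda>i. \<xi> i \<omega>)(k := - \<xi> k \<omega>)) \<in> M \<rightarrow>\<^sub>M Pi\<^sub>M UNIV (\<lambda>_. borel)"
    by (intro measurable_abs_UNIV) simp
  have meas': "(\<lambda>\<omega>. sup_gain G T h ((\<lambda>i. \<xi> i \<omega>)(k := - \<xi> k \<omega>))) \<in> borel_measurable M" for h :: "'t \<Rightarrow> 'n \<Rightarrow> real"
    using measurable_compose[OF flip_meas sup_gain_measurable[OF cont]] .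
  have twice: "2 * expected_gain G T h =
      (\<integral>\<^sup>+\<omega>. sup_gain G T h (\<lambda>i. \<xi> i \<omega>) + sup_gain G T h ((\<lambda>i. \<xi> i \<omega>)(k := - \<xi> k \<omega>)) \<partial>M)"
    for h :: "'t \<Rightarrow> 'n \<Rightarrow> real"
  proof -
    have "(\<lambda>i. \<xi> i \<omega>)(k := - \<xi> k \<omega>) = (\<lambda>i. if i \<in> {k} then - \<xi> i \<omega> else \<xi> i \<omega>)" for \<omega>
      by auto
    then have "(\<integral>\<^sup>+\<omega>. sup_gain G T h ((\<lambda>i. \<xi> i \<omega>)(k := - \<xi> k \<omega>)) \<partial>M) = expected_gain G T h"
      using nn_integral_sign_change[OF sup_gain_measurable[OF cont], where I = "{k}"]
      by (simp only: expected_gain_def)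
    then show ?thesis using nn_integral_add[OF sup_gain_noise_measurable[OF cont] meas', of T h h] by (simp add: expected_gain_def mult_2)
  qed
  have "2 * expected_gain G T w \<le> 2 * expected_gain G T v"
    unfolding twice
    by (intro nn_integral_mono sup_gain_contraction_coordinate[where phi = phi, OF G phi w])
  then show ?thesis by (simp add: ennreal_mult_le_mult_iff)
qed

text \<open>Induction on the set \<open>I\<close> of coordinates that are already
  contracted.\<close>

lemma expected_gain_contraction:
  assumes G: "convex_on UNIV G" "mono G" "\<And>x. 0 \<le> G x"
    and phi: "1-lipschitz_on UNIV phi" "phi 0 = 0"
  shows "expected_gain G T (\<lambda>t i. phi (v t i)) \<le> expected_gain G T v"
proof -
  have "expected_gain G T (\<lambda>t i. if i \<in> I then phi (v t i) else v t i) \<le> expected_gain G T v" for I :: "'n set"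
    using finite[of I]
  proof induction
    case (insert k I)
    have "expected_gain G T (\<lambda>t i. if i \<in> insert k I then phi (v t i) else v t i)
      \<le> expected_gain G T (\<lambda>t i. if i \<in> I then phi (v t i) else v t i)"
      by (rule expected_gain_contraction_coordinate[where k = k and phi = phi, OF G phi]) (use insert in auto)
    with insert.IH show ?case by order
  qed simp
  from this[of UNIV] show ?thesis by simp
qed

lemma expected_exp_form_le:
  fixes a :: "'n \<Rightarrow> real"
  shows "(\<integral>\<^sup>+\<omega>. ennreal (exp (\<Sum>i\<in>UNIV. \<xi> i \<omega> * a i)) \<partial>M) \<le> ennreal (exp ((\<Sum>i\<in>UNIV. (a i)\<^sup>2) / 2))"
proof -
  have "(\<integral>\<^sup>+\<omega>. ennreal (exp (\<Sum>i\<in>UNIV. \<xi> i \<omega> * a i)) \<partial>M) =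
      (\<integral>\<^sup>+\<omega>. (\<Prod>i\<in>UNIV. ennreal (exp (a i * \<xi> i \<omega>))) \<partial>M)"
    by (simp add: exp_sum prod_ennreal mult.commute)
  also have "\<dots> = (\<Prod>i\<in>UNIV. \<integral>\<^sup>+\<omega>. ennreal (exp (a i * \<xi> i \<omega>)) \<partial>M)"
    by (intro indep_vars_nn_integral indep_vars_compose2[OF indep, of "\<lambda>i x. ennreal (exp (a i * x))"]) auto
  also have "\<dots> \<le> (\<Prod>i\<in>UNIV. ennreal (exp ((a i)\<^sup>2 / 2)))"
    by (intro prod_mono_ennreal subgaussian)
  also have "\<dots> = ennreal (exp ((\<Sum>i\<in>UNIV. (a i)\<^sup>2) / 2))"
    by (simp add: prod_ennreal exp_sum sum_divide_distrib)
  finally show ?thesis .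
qed

end

section \<open>Exponential moments through the layers\<close>

abbreviation (input) exp_gain :: "real \<Rightarrow> real \<Rightarrow> real"
  where "exp_gain lam \<equiv> \<lambda>x. exp (lam * pos_part x)"

abbreviation (input) eval_on :: "('n \<Rightarrow> 'x) \<Rightarrow> ('x \<Rightarrow> real) \<Rightarrow> 'n \<Rightarrow> real"
  where "eval_on X \<equiv> \<lambda>f i. f (X i)"

lemma pos_part_lipschitz: "1-lipschitz_on UNIV pos_part"
  by (auto simp: lipschitz_on_def pos_part_def dist_real_def)

lemma convex_exp_gain:
  assumes "0 \<le> lam"
  shows "convex_on UNIV (exp_gain lam)"
proof (rule convex_onI)
  fix t x y :: real
  assume t: "0 < t" "t < 1"
  have "(1 - t) * x \<le> (1 - t) * pos_part x" "t * y \<le> t * pos_part y"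
    "0 \<le> (1 - t) * pos_part x" "0 \<le> t * pos_part y"
    using t by (auto simp: pos_part_def intro!: mult_left_mono)
  then have "pos_part ((1 - t) * x + t * y) \<le> (1 - t) * pos_part x + t * pos_part y"
    by (simp add: pos_part_def[of "(1 - t) * x + t * y"])
  then have "lam * pos_part ((1 - t) * x + t * y) \<le> (1 - t) * (lam * pos_part x) + t * (lam * pos_part y)"
    using mult_left_mono[OF _ assms] by (fastforce simp: algebra_simps)
  then have "exp (lam * pos_part ((1 - t) * x + t * y)) \<le> exp ((1 - t) * (lam * pos_part x) + t * (lam * pos_part y))"
    by simp
  also have "\<dots> \<le> (1 - t) * exp (lam * pos_part x) + t * exp (lam * pos_part y)"
    using convex_onD[OF exp_convex, of t "lam * pos_part x" "lam * pos_part y"] t by simp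
  finally show "exp_gain lam ((1 - t) *\<^sub>R x + t *\<^sub>R y) \<le> (1 - t) * exp_gain lam x + t * exp_gain lam y"
    by simp
qed simp

lemma mono_exp_gain: "0 \<le> lam \<Longrightarrow> mono (exp_gain lam)"
  by (auto intro!: monoI mult_left_mono simp: pos_part_def)

lemma continuous_exp_gain: "continuous_on UNIV (exp_gain lam)"
  unfolding pos_part_def by (intro continuous_intros)

text \<open>A linear form is bounded on the symmetric convex hull by its absolute value at one generator,
  and the positive parts of the form and of its negative are the values at the noises \<open>z\<close> and \<open>- z\<close>.\<close>

lemma sup_gain_next_layer_le:
  assumes "F \<noteq> {}" "0 \<le> lam"
  shows "sup_gain (exp_gain lam) (next_layer F) (eval_on X) z
    \<le> sup_gain (exp_gain lam) F (\<lambda>f i. pos_part (f (X i))) z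
      + sup_gain (exp_gain lam) F (\<lambda>f i. pos_part (f (X i))) (\<lambda>i. - z i)" (is "_ \<le> ?S + ?S'")
proof -
  have S: "ennreal (exp_gain lam (\<Sum>i\<in>UNIV. z i * pos_part (f (X i)))) \<le> ?S"
    "ennreal (exp_gain lam (- (\<Sum>i\<in>UNIV. z i * pos_part (f (X i))))) \<le> ?S'" if "f \<in> F" for f
    unfolding sup_gain_def by (intro SUP_upper2[OF that]; simp add: sum_negf)+
  have "ennreal (exp_gain lam (\<Sum>i\<in>UNIV. z i * (\<Sum>j<m. c j * pos_part (f j (X i))))) \<le> ?S + ?S'"
    if f: "\<And>j. j < m \<Longrightarrow> f j \<in> F" and c: "(\<Sum>j<m. \<bar>c j\<bar>) \<le> 1" for m :: nat and c :: "nat \<Rightarrow> real" and f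
  proof -
    define r where "r j = (\<Sum>i\<in>UNIV. z i * pos_part (f j (X i)))" for j
    have sum: "(\<Sum>i\<in>UNIV. z i * (\<Sum>j<m. c j * pos_part (f j (X i)))) = (\<Sum>j<m. c j * r j)"
      unfolding r_def sum_distrib_left by (subst sum.swap) (simp add: mult_ac)
    \<comment> \<open>The witness is the unit \<open>f J\<close> with the largest
      \<open>\<bar>r J\<bar>\<close>. The empty network \<open>m = 0\<close> has value 0 and any
      element of \<open>F\<close> serves, which is where \<open>F \<noteq> {}\<close>
      enters.\<close>
    have "\<exists>g\<in>F. pos_part (\<Sum>j<m. c j * r j) \<le> \<bar>\<Sum>i\<in>UNIV. z i * pos_part (g (X i))\<bar>"
    proof (cases "m = 0")
      case True
      then show ?thesis using assms(1) by (auto simp: pos_part_def)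
    next
      case False
      define b where "b = Max ((\<lambda>j. \<bar>r j\<bar>) ` {..<m})"
      have "b \<in> (\<lambda>j. \<bar>r j\<bar>) ` {..<m}" unfolding b_def using False by (intro Max_in) auto
      then obtain J where J: "J < m" "b = \<bar>r J\<bar>" by auto
      have b: "\<bar>r j\<bar> \<le> b" if "j < m" for j unfolding b_def using that by (intro Max_ge) auto
      have "(\<Sum>j<m. c j * r j) \<le> (\<Sum>j<m. \<bar>c j\<bar> * b)"
      proof (rule sum_mono)
        fix j assume "j \<in> {..<m}"
        have "c j * r j \<le> \<bar>c j\<bar> * \<bar>r j\<bar>" by (metis abs_ge_self abs_mult)
        also have "\<dots> \<le> \<bar>c j\<bar> * b" using b \<open>j \<in> {..<m}\<close> by (intro mult_left_mono) auto
        finally show "c j * r j \<le> \<bar>c j\<bar> * b" .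
      qed
      also have "\<dots> \<le> b" using mult_right_mono[OF c, of b] J by (simp add: sum_distrib_right)
      finally show ?thesis using J f by (auto simp: pos_part_def r_def intro!: bexI[of _ "f J"])
    qed
    then obtain g where g: "g \<in> F" and
      le: "pos_part (\<Sum>j<m. c j * r j) \<le> \<bar>\<Sum>i\<in>UNIV. z i * pos_part (g (X i))\<bar>" (is "_ \<le> \<bar>?t\<bar>") ..
    have "exp_gain lam (\<Sum>j<m. c j * r j) \<le> exp (lam * \<bar>?t\<bar>)"
      using le assms(2) by (simp add: mult_left_mono)
    \<comment> \<open>One of the two summands equals the left side, and the other is
      nonnegative.\<close>
    also have "\<dots> \<le> exp_gain lam ?t + exp_gain lam (- ?t)"
      by (cases "?t \<ge> 0") (auto simp: pos_part_def)
    finally have "ennreal (exp_gain lam (\<Sum>j<m. c j * r j)) \<le> ennreal (exp_gain lam ?t) + ennreal (exp_gain lam (- ?t))"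
      by (simp flip: ennreal_plus)
    also have "\<dots> \<le> ?S + ?S'" by (intro add_mono S g)
    finally show ?thesis unfolding sum .
  qed
  then show ?thesis
    by (subst sup_gain_def) (auto simp: next_layer_def intro!: SUP_least)
qed

lemma next_layer_nonempty: "next_layer F \<noteq> {}"
  unfolding next_layer_def by (auto intro!: exI[of _ 0])

lemma layers_nonempty: "(next_layer ^^ L) (input_layer V) \<noteq> {}"
  by (cases L) (auto simp: input_layer_def next_layer_nonempty)

context symmetric_subgaussian_noise
begin

text \<open>The noises \<open>\<xi>\<close> and \<open>- \<xi>\<close> have the same law, so the two
  suprema for the convex hull have equal expectation; this is the factor 2. Contraction then removes
  \<open>pos_part\<close> at no cost.\<close>

lemma expected_gain_next_layer_le:
  assumes "F \<noteq> {}" "0 \<le> lam"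
  shows "expected_gain (exp_gain lam) (next_layer F) (eval_on X) \<le> 2 * expected_gain (exp_gain lam) F (eval_on X)"
proof -
  let ?s = "sup_gain (exp_gain lam) F (\<lambda>f i. pos_part (f (X i)))"
  note meas = sup_gain_measurable[OF continuous_exp_gain, of lam F "\<lambda>f i. pos_part (f (X i))"]
  have neg: "(\<lambda>\<omega> i. - \<xi> i \<omega>) \<in> M \<rightarrow>\<^sub>M Pi\<^sub>M UNIV (\<lambda>_. borel)"
    by (intro measurable_abs_UNIV) simp
  have "expected_gain (exp_gain lam) (next_layer F) (eval_on X)
      \<le> (\<integral>\<^sup>+\<omega>. ?s (\<lambda>i. \<xi> i \<omega>) + ?s (\<lambda>i. - \<xi> i \<omega>) \<partial>M)"
    unfolding expected_gain_def by (intro nn_integral_mono sup_gain_next_layer_le assms)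
  also have "\<dots> = (\<integral>\<^sup>+\<omega>. ?s (\<lambda>i. \<xi> i \<omega>) \<partial>M) + (\<integral>\<^sup>+\<omega>. ?s (\<lambda>i. - \<xi> i \<omega>) \<partial>M)"
    by (intro nn_integral_add measurable_compose[OF vector_measurable meas] measurable_compose[OF neg meas])
  also have "\<dots> = 2 * expected_gain (exp_gain lam) F (\<lambda>f i. pos_part (f (X i)))"
    using nn_integral_sign_change[OF meas, of UNIV] by (simp add: expected_gain_def mult_2)
  also have "\<dots> \<le> 2 * expected_gain (exp_gain lam) F (eval_on X)"
    using assms(2)
    by (intro mult_left_mono expected_gain_contraction[of _ pos_part] convex_exp_gain mono_exp_gain pos_part_lipschitz)
      (auto simp: pos_part_def)
  finally show ?thesis .
qed

text \<open>The supremum is bounded by a sum over coordinates. The positive part costs nothing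
  beyond the \<open>2 d\<close> terms: the generators \<open>V * x $ j\<close> and
  \<open>- (V * x $ j)\<close> are both dominated by the same sum
  \<open>e 1 j + e (- 1) j\<close>.\<close>

lemma expected_gain_input_layer_le:
  fixes X :: "'n \<Rightarrow> real^'d::finite"
  assumes X: "\<And>i j. X i $ j \<in> {-1..1}" and "0 \<le> lam"
  shows "expected_gain (exp_gain lam) (input_layer V) (eval_on X)
    \<le> ennreal (2 * real CARD('d) * exp ((lam * V)\<^sup>2 * real CARD('n) / 2))"
proof -
  define e where "e s j \<omega> = ennreal (exp (\<Sum>i\<in>UNIV. \<xi> i \<omega> * (s * (lam * V * X i $ j))))" for s j \<omega>
  have [measurable]: "e s j \<in> borel_measurable M" for s j
    unfolding e_def by measurable
  have exp_gain_le: "exp_gain lam u \<le> exp (lam * u) + exp (lam * (- u))" for u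
  proof (cases "0 \<le> u")
    case False
    then have "0 \<le> lam * (- u)" using assms(2) by (intro mult_nonneg_nonneg) auto
    then have "1 \<le> exp (lam * (- u))" by simp
    with exp_ge_zero[of "lam * u"] have "1 \<le> exp (lam * u) + exp (lam * (- u))" by linarith
    then show ?thesis using False by (simp add: pos_part_def)
  qed (simp add: pos_part_def)
  have forms: "lam * (\<Sum>i\<in>UNIV. \<xi> i \<omega> * (V * X i $ j)) = (\<Sum>i\<in>UNIV. \<xi> i \<omega> * (1 * (lam * V * X i $ j)))"
    "lam * (- (\<Sum>i\<in>UNIV. \<xi> i \<omega> * (V * X i $ j))) = (\<Sum>i\<in>UNIV. \<xi> i \<omega> * (- 1 * (lam * V * X i $ j)))"
    for \<omega> j
    by (simp_all add: sum_distrib_left sum_negf mult_ac)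
  have coordinate: "ennreal (exp_gain lam (\<Sum>i\<in>UNIV. \<xi> i \<omega> * f (X i))) \<le> e 1 j \<omega> + e (- 1) j \<omega>"
    if "f = (\<lambda>x. V * x $ j) \<or> f = (\<lambda>x. - (V * x $ j))" for f j \<omega>
    unfolding e_def forms[symmetric]
    using that exp_gain_le[of "\<Sum>i\<in>UNIV. \<xi> i \<omega> * (V * X i $ j)"]
      exp_gain_le[of "- (\<Sum>i\<in>UNIV. \<xi> i \<omega> * (V * X i $ j))"]
    by (auto simp: sum_negf add.commute simp flip: ennreal_plus)
  have "expected_gain (exp_gain lam) (input_layer V) (eval_on X) \<le> (\<integral>\<^sup>+\<omega>. (\<Sum>j\<in>UNIV. e 1 j \<omega> + e (- 1) j \<omega>) \<partial>M)"
    unfolding expected_gain_def sup_gain_def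
  proof (intro nn_integral_mono SUP_least)
    fix \<omega> and f :: "real^'d \<Rightarrow> real"
    assume "f \<in> input_layer V"
    then obtain j where "f = (\<lambda>x. V * x $ j) \<or> f = (\<lambda>x. - (V * x $ j))" by (auto simp: input_layer_def)
    from coordinate[OF this]
    have "ennreal (exp_gain lam (\<Sum>i\<in>UNIV. \<xi> i \<omega> * f (X i))) \<le> e 1 j \<omega> + e (- 1) j \<omega>" .
    also have "\<dots> \<le> (\<Sum>j\<in>UNIV. e 1 j \<omega> + e (- 1) j \<omega>)" by (intro member_le_sum) auto
    finally show "ennreal (exp_gain lam (\<Sum>i\<in>UNIV. \<xi> i \<omega> * f (X i))) \<le> (\<Sum>j\<in>UNIV. e 1 j \<omega> + e (- 1) j \<omega>)" .
  qed
  also have "\<dots> = (\<Sum>j\<in>UNIV. (\<integral>\<^sup>+\<omega>. e 1 j \<omega> \<partial>M) + (\<integral>\<^sup>+\<omega>. e (- 1) j \<omega> \<partial>M))"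
    by (simp add: nn_integral_sum nn_integral_add)
  also have "\<dots> \<le> (\<Sum>j\<in>(UNIV::'d set). ennreal (2 * exp ((lam * V)\<^sup>2 * real CARD('n) / 2)))"
  proof (rule sum_mono)
    fix j :: 'd
    have "(\<integral>\<^sup>+\<omega>. e s j \<omega> \<partial>M) \<le> ennreal (exp ((lam * V)\<^sup>2 * real CARD('n) / 2))" if s: "s\<^sup>2 = 1" for s
    proof -
      have "(X i $ j)\<^sup>2 \<le> 1" for i using X[of i j] by (simp add: abs_square_le_1 abs_le_iff)
      then have "(s * (lam * V * X i $ j))\<^sup>2 \<le> (lam * V)\<^sup>2" for i
        using s by (simp add: power_mult_distrib mult_left_le)
      then have "(\<Sum>i\<in>(UNIV::'n set). (s * (lam * V * X i $ j))\<^sup>2) \<le> (\<Sum>i\<in>(UNIV::'n set). (lam * V)\<^sup>2)"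
        by (intro sum_mono)
      then have "ennreal (exp ((\<Sum>i\<in>(UNIV::'n set). (s * (lam * V * X i $ j))\<^sup>2) / 2))
          \<le> ennreal (exp ((lam * V)\<^sup>2 * real CARD('n) / 2))"
        by (intro ennreal_leI) (simp add: mult.commute)
      then show ?thesis
        unfolding e_def using expected_exp_form_le[of "\<lambda>i. s * (lam * V * X i $ j)"] by order
    qed
    from this[of 1] this[of "-1"]
    have "(\<integral>\<^sup>+\<omega>. e 1 j \<omega> \<partial>M) + (\<integral>\<^sup>+\<omega>. e (- 1) j \<omega> \<partial>M)
      \<le> ennreal (exp ((lam * V)\<^sup>2 * real CARD('n) / 2)) + ennreal (exp ((lam * V)\<^sup>2 * real CARD('n) / 2))"
      by (intro add_mono) auto
    then show "(\<integral>\<^sup>+\<omega>. e 1 j \<omega> \<partial>M) + (\<integral>\<^sup>+\<omega>. e (- 1) j \<omega> \<partial>M) \<le> ennreal (2 * exp ((lam * V)\<^sup>2 * real CARD('n) / 2))"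
      by (simp flip: ennreal_plus)
  qed
  also have "\<dots> = ennreal (2 * real CARD('d) * exp ((lam * V)\<^sup>2 * real CARD('n) / 2))"
    by (simp add: ennreal_of_nat_eq_real_of_nat mult_ac flip: ennreal_mult)
  finally show ?thesis .
qed

lemma expected_gain_layers_le:
  fixes X :: "'n \<Rightarrow> real^'d::finite"
  assumes X: "\<And>i j. X i $ j \<in> {-1..1}" and "0 \<le> lam"
  shows "expected_gain (exp_gain lam) ((next_layer ^^ L) (input_layer V)) (eval_on X)
    \<le> ennreal (2 ^ L * (2 * real CARD('d) * exp ((lam * V)\<^sup>2 * real CARD('n) / 2)))"
proof (induction L)
  case 0
  then show ?case using expected_gain_input_layer_le[OF assms, of V] by simp
next
  case (Suc L)
  have "expected_gain (exp_gain lam) ((next_layer ^^ Suc L) (input_layer V)) (eval_on X)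
      \<le> 2 * expected_gain (exp_gain lam) ((next_layer ^^ L) (input_layer V)) (eval_on X)"
    using expected_gain_next_layer_le[OF layers_nonempty assms(2)] by simp
  also have "\<dots> \<le> ennreal 2 * ennreal (2 ^ L * (2 * real CARD('d) * exp ((lam * V)\<^sup>2 * real CARD('n) / 2)))"
    using mult_left_mono[OF Suc, of 2] by simp
  also have "\<dots> = ennreal (2 * (2 ^ L * (2 * real CARD('d) * exp ((lam * V)\<^sup>2 * real CARD('n) / 2))))"
    by (rule ennreal_mult[symmetric]) auto
  finally show ?case by (simp only: power_Suc mult.assoc)
qed

section \<open>Upper and lower bounds for the exponential complexity\<close>

lemma psi_complexity_eq:
  "psi_complexity lam M \<xi> A = ereal (1 / lam) * ext_ln (expected_gain (exp_gain lam) A (\<lambda>a i. a $ i))"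
  by (simp add: psi_complexity_def expected_gain_def sup_gain_def linear_form_def)

text \<open>The output function is one more contraction fixing 0, so it is stripped off before the
  layer bound is applied and the logarithm taken.\<close>

lemma psi_complexity_network_le:
  fixes X :: "'n \<Rightarrow> real^'d::finite"
  assumes X: "\<And>i j. X i $ j \<in> {-1..1}" and "0 < lam"
    and phi: "1-lipschitz_on UNIV phi_out" "phi_out 0 = 0"
  shows "psi_complexity lam M \<xi> (values_on_data (network_class phi_out L V) X)
    \<le> ereal ((real L * ln 2 + ln (2 * real CARD('d)) + (lam * V)\<^sup>2 * real CARD('n) / 2) / lam)"
proof -
  let ?r = "2 ^ L * (2 * real CARD('d) * exp ((lam * V)\<^sup>2 * real CARD('n) / 2))"
  let ?E = "expected_gain (exp_gain lam) (values_on_data (network_class phi_out L V) X) (\<lambda>a i. a $ i)"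
  have "?E = expected_gain (exp_gain lam) ((next_layer ^^ L) (input_layer V)) (\<lambda>f i. phi_out (f (X i)))"
    by (simp add: expected_gain_def sup_gain_def values_on_data_def network_class_def image_image)
  also have "\<dots> \<le> expected_gain (exp_gain lam) ((next_layer ^^ L) (input_layer V)) (eval_on X)"
    using assms(2) by (intro expected_gain_contraction phi convex_exp_gain mono_exp_gain) auto
  also have "\<dots> \<le> ennreal ?r" using assms by (intro expected_gain_layers_le) auto
  finally have E: "?E \<le> ennreal ?r" .
  then have "?E \<noteq> \<top>" by (auto simp: top_unique)
  then obtain q where q: "0 \<le> q" "?E = ennreal q" by (cases ?E rule: ennreal_cases) auto
  with E have "q \<le> ?r" by (metis ennreal_le_iff mult_nonneg_nonneg exp_ge_zero of_nat_0_le_iff zero_le_numeral zero_le_power)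
  then have "ext_ln ?E \<le> ereal (ln ?r)"
    using q by (auto simp: ext_ln_def)
  then have "ereal (1 / lam) * ext_ln ?E \<le> ereal (1 / lam) * ereal (ln ?r)"
    using assms(2) by (intro ereal_mult_left_mono) auto
  also have "ln ?r = real L * ln 2 + ln (2 * real CARD('d)) + (lam * V)\<^sup>2 * real CARD('n) / 2"
    by (simp add: ln_mult ln_realpow)
  finally show ?thesis by (simp add: psi_complexity_eq)
qed

text \<open>Jensen's inequality for the logarithm, in the form of the tangent line of the exponential at
  the logarithm of its mean.\<close>

lemma complexity_le_psi_complexity:
  fixes A :: "(real^'n) set"
  assumes "A \<noteq> {}" "0 < lam"
  shows "enn2ereal (complexity M \<xi> A) \<le> psi_complexity lam M \<xi> A"
proof -
  let ?P = "\<lambda>\<omega>. sup_gain pos_part A (\<lambda>a i. a $ i) (\<lambda>i. \<xi> i \<omega>)"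
  let ?T = "\<lambda>\<omega>. sup_gain (exp_gain lam) A (\<lambda>a i. a $ i) (\<lambda>i. \<xi> i \<omega>)"
  let ?E = "expected_gain (exp_gain lam) A (\<lambda>a i. a $ i)"
  have complexity: "complexity M \<xi> A = (\<integral>\<^sup>+\<omega>. ?P \<omega> \<partial>M)"
    by (simp add: complexity_def sup_gain_def linear_form_def)
  have [measurable]: "?P \<in> borel_measurable M" "?T \<in> borel_measurable M"
    by (intro sup_gain_noise_measurable continuous_exp_gain)+
      (auto simp: pos_part_def[abs_def] intro!: sup_gain_noise_measurable continuous_intros)
  have "1 \<le> ?T \<omega>" for \<omega>
  proof -
    obtain a where "a \<in> A" using assms(1) by blast
    then show ?thesis unfolding sup_gain_def
      using assms(2) by (intro SUP_upper2[of a]) (auto simp: pos_part_def)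
  qed
  then have "(\<integral>\<^sup>+\<omega>. 1 \<partial>M) \<le> (\<integral>\<^sup>+\<omega>. ?T \<omega> \<partial>M)" by (intro nn_integral_mono)
  \<comment> \<open>This makes the logarithm of the mean nonnegative, so it can be embedded in
    \<open>ennreal\<close>.\<close>
  then have E1: "1 \<le> ?E" by (simp add: expected_gain_def emeasure_space_1)
  show ?thesis
  proof (cases "?E = \<infinity>")
    case True
    then show ?thesis using assms(2) by (simp add: psi_complexity_eq ext_ln_def)
  next
    case False
    then obtain r where r: "0 \<le> r" "?E = ennreal r" by (cases ?E rule: ennreal_cases) auto
    then have r1: "1 \<le> r" using E1 by simp
    \<comment> \<open>The tangent line at \<open>ln r\<close>, divided by \<open>lam\<close> and
      arranged without subtraction. After integration the last term becomes \<open>1 / lam\<close>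
      and cancels against the left side.\<close>
    have "?P \<omega> + ennreal (1 / lam) \<le> ennreal (ln r / lam) + ennreal (1 / (lam * r)) * ?T \<omega>" for \<omega>
    proof -
      have "ennreal (pos_part u) + ennreal (1 / lam) \<le> ennreal (ln r / lam) + ennreal (1 / (lam * r)) * ennreal (exp_gain lam u)" for u
      proof -
        have "1 + (lam * pos_part u - ln r) \<le> exp (lam * pos_part u - ln r)" by (rule exp_ge_add_one_self)
        also have "\<dots> = exp_gain lam u / r" using r1 by (simp add: exp_diff)
        finally have "(lam * pos_part u + 1) / lam \<le> (ln r + exp_gain lam u / r) / lam"
          using assms(2) by (intro divide_right_mono) auto
        then have "pos_part u + 1 / lam \<le> ln r / lam + 1 / (lam * r) * exp_gain lam u"
          using assms(2) by (simp add: add_divide_distrib mult.commute)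
        then have "ennreal (pos_part u + 1 / lam) \<le> ennreal (ln r / lam + 1 / (lam * r) * exp_gain lam u)"
          by (rule ennreal_leI)
        moreover have "0 \<le> pos_part u" by (simp add: pos_part_def)
        ultimately show ?thesis using r1 assms(2) by (simp add: ennreal_plus ennreal_mult del: times_divide_eq_left)
      qed
      then have "ennreal (pos_part u) + ennreal (1 / lam) \<le> ennreal (ln r / lam) + ennreal (1 / (lam * r)) * ?T \<omega>"
        if "u \<in> (\<lambda>a. \<Sum>i\<in>UNIV. \<xi> i \<omega> * a $ i) ` A" for u
        using that unfolding sup_gain_def
        by (force intro: order.trans[OF _ add_left_mono[OF mult_left_mono[OF SUP_upper]]])
      then show ?thesis
        unfolding sup_gain_def[of pos_part] ennreal_SUP_add_left[OF assms(1), symmetric]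
        by (intro SUP_least) auto
    qed
    then have "(\<integral>\<^sup>+\<omega>. ?P \<omega> + ennreal (1 / lam) \<partial>M) \<le> (\<integral>\<^sup>+\<omega>. ennreal (ln r / lam) + ennreal (1 / (lam * r)) * ?T \<omega> \<partial>M)"
      by (intro nn_integral_mono)
    then have "complexity M \<xi> A + ennreal (1 / lam) \<le> ennreal (ln r / lam) + ennreal (1 / (lam * r)) * ennreal r"
      using r(2) by (simp add: nn_integral_add nn_integral_cmult complexity emeasure_space_1 expected_gain_def)
    also have "ennreal (1 / (lam * r)) * ennreal r = ennreal (1 / lam)"
      using r1 assms(2) by (simp flip: ennreal_mult)
    finally have "complexity M \<xi> A \<le> ennreal (ln r / lam)"
      by (simp add: ennreal_add_left_cancel_le add.commute)
    then have "enn2ereal (complexity M \<xi> A) \<le> ereal (ln r / lam)"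
      using r1 assms(2) by (metis enn2ereal_ennreal less_eq_ennreal.rep_eq ln_ge_zero divide_nonneg_pos)
    then show ?thesis using r r1 by (simp add: psi_complexity_eq ext_ln_def)
  qed
qed

end

section \<open>The Rademacher and standard normal laws are symmetric and subgaussian\<close>

text \<open>The two atoms carry total mass 1, so \<open>Y\<close> is almost surely 1 or -1.\<close>

lemma (in prob_space) rademacher_nn_integral:
  assumes Y: "rademacher_variable M Y" and f: "f \<in> borel_measurable borel"
  shows "(\<integral>\<^sup>+\<omega>. f (Y \<omega>) \<partial>M) = f 1 * ennreal (1 / 2) + f (-1) * ennreal (1 / 2)"
proof -
  let ?A = "{\<omega> \<in> space M. Y \<omega> = 1}" and ?B = "{\<omega> \<in> space M. Y \<omega> = -1}"
  have [measurable]: "Y \<in> borel_measurable M" and half: "prob ?A = 1 / 2" "prob ?B = 1 / 2"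
    using Y by (auto simp: rademacher_variable_def)
  have "prob (?A \<union> ?B) = prob ?A + prob ?B" by (intro finite_measure_Union) auto
  then have "AE \<omega> in M. \<omega> \<in> ?A \<union> ?B" using half by (subst AE_in_set_eq_1) auto
  then have "(\<integral>\<^sup>+\<omega>. f (Y \<omega>) \<partial>M) = (\<integral>\<^sup>+\<omega>. f 1 * indicator ?A \<omega> + f (-1) * indicator ?B \<omega> \<partial>M)"
    by (intro nn_integral_cong_AE) (auto elim!: eventually_mono split: split_indicator)
  also have "\<dots> = f 1 * emeasure M ?A + f (-1) * emeasure M ?B"
    by (subst nn_integral_add) (auto simp: nn_integral_cmult_indicator)
  finally show ?thesis by (simp add: emeasure_eq_measure half)
qed

lemma (in prob_space) distr_eqI_nn_integral:
  assumes [measurable]: "X \<in> borel_measurable M" "Y \<in> borel_measurable M"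
    and eq: "\<And>f. f \<in> borel_measurable borel \<Longrightarrow> (\<integral>\<^sup>+\<omega>. f (X \<omega>) \<partial>M) = (\<integral>\<^sup>+\<omega>. f (Y \<omega>) \<partial>M)"
  shows "distr M borel X = distr M borel Y"
proof (rule measure_eqI)
  fix B assume "B \<in> sets (distr M borel X)"
  then have B [measurable]: "B \<in> sets borel" by simp
  have "emeasure (distr M borel Z) B = (\<integral>\<^sup>+\<omega>. indicator B (Z \<omega>) \<partial>M)"
    if [measurable]: "Z \<in> borel_measurable M" for Z
    using nn_integral_distr[OF that, of "indicator B"] by simp
  then show "emeasure (distr M borel X) B = emeasure (distr M borel Y) B" by (simp add: eq)
qed simp

text \<open>This is \<open>ln (cosh t) \<le> t\<^sup>2 / 2\<close>, obtained at \<open>h = 2 t\<close>, \<open>p = 1 / 2\<close> from the calculus part of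
  Hoeffding's lemma.\<close>

lemma cosh_le_exp_half_square: "(exp t + exp (- t)) / 2 \<le> exp (t\<^sup>2 / 2)" for t :: real
proof -
  \<comment> \<open>The Hoeffding inequality is applied for nonnegative arguments; the claim is even
    in \<open>t\<close>.\<close>
  have *: "(exp t + exp (- t)) / 2 \<le> exp (t\<^sup>2 / 2)" if "0 \<le> t" for t :: real
  proof -
    have pos: "0 < 1 + 1 / 2 * (exp (2 * t) - 1)"
      using exp_gt_zero[of "2 * t"] by (simp add: field_simps add_pos_pos)
    have "- (2 * t) * (1 / 2) + ln (1 + 1 / 2 * (exp (2 * t) - 1)) \<le> (2 * t)\<^sup>2 / 8"
      using that by (intro Hoeffdings_lemma_aux) auto
    then have "exp (- t + ln (1 + 1 / 2 * (exp (2 * t) - 1))) \<le> exp (t\<^sup>2 / 2)"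
      by (simp add: power_mult_distrib)
    also have "exp (- t + ln (1 + 1 / 2 * (exp (2 * t) - 1))) = exp (- t) * (1 + 1 / 2 * (exp (2 * t) - 1))"
      using pos by (simp only: exp_add exp_ln)
    also have "\<dots> = (exp (- t) + exp (- t) * exp (2 * t)) / 2"
      by (simp add: field_simps)
    also have "exp (- t) * exp (2 * t) = exp t" by (simp flip: exp_add)
    finally show ?thesis by (simp add: add.commute)
  qed
  show ?thesis using *[of t] *[of "- t"] by (cases "0 \<le> t") (auto simp: add.commute)
qed

lemma (in prob_space) rademacher_symmetric:
  assumes "rademacher_variable M Y"
  shows "distr M borel (\<lambda>\<omega>. - Y \<omega>) = distr M borel Y"
proof (rule distr_eqI_nn_integral)
  show [measurable]: "Y \<in> borel_measurable M" using assms by (simp add: rademacher_variable_def)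
  then show "(\<lambda>\<omega>. - Y \<omega>) \<in> borel_measurable M" by simp
  fix f :: "real \<Rightarrow> ennreal" assume [measurable]: "f \<in> borel_measurable borel"
  have "(\<lambda>x. f (- x)) \<in> borel_measurable borel" by measurable
  then show "(\<integral>\<^sup>+\<omega>. f (- Y \<omega>) \<partial>M) = (\<integral>\<^sup>+\<omega>. f (Y \<omega>) \<partial>M)"
    using rademacher_nn_integral[OF assms, of f] rademacher_nn_integral[OF assms, of "\<lambda>x. f (- x)"]
    by (simp add: add.commute)
qed

lemma (in prob_space) rademacher_subgaussian:
  assumes "rademacher_variable M Y"
  shows "(\<integral>\<^sup>+\<omega>. ennreal (exp (t * Y \<omega>)) \<partial>M) \<le> ennreal (exp (t\<^sup>2 / 2))"
proof -
  have "(\<integral>\<^sup>+\<omega>. ennreal (exp (t * Y \<omega>)) \<partial>M)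
      = ennreal (exp (t * 1)) * ennreal (1 / 2) + ennreal (exp (t * - 1)) * ennreal (1 / 2)"
    by (intro rademacher_nn_integral[OF assms]) measurable
  also have "\<dots> = ennreal (exp (t * 1) * (1 / 2) + exp (t * - 1) * (1 / 2))"
    by (simp only: ennreal_plus ennreal_mult exp_ge_zero mult_nonneg_nonneg zero_le_divide_1_iff zero_le_numeral)
  also have "\<dots> = ennreal ((exp t + exp (- t)) / 2)"
    by (simp add: add_divide_distrib)
  also have "\<dots> \<le> ennreal (exp (t\<^sup>2 / 2))" by (intro ennreal_leI cosh_le_exp_half_square)
  finally show ?thesis .
qed

lemma (in prob_space) std_normal_symmetric:
  assumes Y: "std_normal_variable M Y"
  shows "distr M borel (\<lambda>\<omega>. - Y \<omega>) = distr M borel Y"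
proof (rule distr_eqI_nn_integral)
  have D: "distributed M lborel Y std_normal_density" using Y by (simp add: std_normal_variable_def)
  show [measurable]: "Y \<in> borel_measurable M" using distributed_measurable[OF D] by simp
  then show "(\<lambda>\<omega>. - Y \<omega>) \<in> borel_measurable M" by simp
  fix f :: "real \<Rightarrow> ennreal" assume [measurable]: "f \<in> borel_measurable borel"
  have "(\<integral>\<^sup>+\<omega>. f (- Y \<omega>) \<partial>M) = (\<integral>\<^sup>+x. ennreal (std_normal_density x) * f (- x) \<partial>lborel)"
    using distributed_nn_integral[OF D, of "\<lambda>x. f (- x)"] by simp
  also have "\<dots> = (\<integral>\<^sup>+x. ennreal (std_normal_density x) * f x \<partial>lborel)"
    by (subst nn_integral_real_affine[where c = "-1" and t = 0]) (auto simp: normal_density_def)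
  also have "\<dots> = (\<integral>\<^sup>+\<omega>. f (Y \<omega>) \<partial>M)"
    using distributed_nn_integral[OF D, of f] by simp
  finally show "(\<integral>\<^sup>+\<omega>. f (- Y \<omega>) \<partial>M) = (\<integral>\<^sup>+\<omega>. f (Y \<omega>) \<partial>M)" .
qed

text \<open>Completing the square turns the tilted density into \<open>exp (t\<^sup>2 / 2)\<close>
  times the normal density with mean \<open>t\<close>, whose integral is 1.\<close>

lemma (in prob_space) std_normal_subgaussian:
  assumes Y: "std_normal_variable M Y"
  shows "(\<integral>\<^sup>+\<omega>. ennreal (exp (t * Y \<omega>)) \<partial>M) \<le> ennreal (exp (t\<^sup>2 / 2))"
proof -
  have D: "distributed M lborel Y std_normal_density" using Y by (simp add: std_normal_variable_def)
  have density: "std_normal_density x * exp (t * x) = exp (t\<^sup>2 / 2) * normal_density t 1 x" for x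
  proof -
    have "- x\<^sup>2 / 2 + t * x = t\<^sup>2 / 2 + (- (x - t)\<^sup>2 / 2)"
      by (simp add: power2_eq_square field_simps)
    then have "exp (- x\<^sup>2 / 2) * exp (t * x) = exp (t\<^sup>2 / 2) * exp (- (x - t)\<^sup>2 / 2)"
      by (simp only: exp_add[symmetric])
    then show ?thesis by (simp add: normal_density_def)
  qed
  have "(\<integral>\<^sup>+\<omega>. ennreal (exp (t * Y \<omega>)) \<partial>M) = (\<integral>\<^sup>+x. ennreal (std_normal_density x) * ennreal (exp (t * x)) \<partial>lborel)"
    using distributed_nn_integral[OF D, of "\<lambda>x. ennreal (exp (t * x))"] by simp
  also have "\<dots> = (\<integral>\<^sup>+x. ennreal (exp (t\<^sup>2 / 2)) * ennreal (normal_density t 1 x) \<partial>lborel)"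
    by (simp only: ennreal_mult[symmetric] normal_density_nonneg exp_ge_zero density)
  also have "\<dots> = ennreal (exp (t\<^sup>2 / 2)) * (\<integral>\<^sup>+x. ennreal (normal_density t 1 x) \<partial>lborel)"
    by (simp add: nn_integral_cmult)
  also have "(\<integral>\<^sup>+x. ennreal (normal_density t 1 x) \<partial>lborel) = 1"
    by (subst nn_integral_eq_integral) auto
  finally show ?thesis by simp
qed

section \<open>Optimisation of the exponential parameter\<close>

text \<open>The condition \<open>phi_out 0 = 0\<close> excludes constant output functions
  \<open>c \<noteq> 0\<close>: these are 1-Lipschitz, but give the complexity
  \<open>\<bar>c\<bar>\<close> times the mean positive part of the sum of the noise, which is
  unbounded in \<open>c\<close>. The parameter \<open>lam\<close> is chosen before the data, hence
  uniformly.\<close>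

theorem corollary2:
  fixes L :: nat and V :: real and phi_out :: "real \<Rightarrow> real"
    and M :: "'a measure" and \<xi> :: "'n::finite \<Rightarrow> 'a \<Rightarrow> real"
  assumes "L \<ge> 1" and "V > 0"
    and lipschitz: "1-lipschitz_on UNIV phi_out" and phi_out_zero: "phi_out 0 = 0"
    and "prob_space M"
    and indep: "prob_space.indep_vars M (\<lambda>_. borel) \<xi> UNIV"
    and law: "(\<forall>i. rademacher_variable M (\<xi> i)) \<or> (\<forall>i. std_normal_variable M (\<xi> i))"
  shows "\<exists>lam>0. \<forall>X :: 'n \<Rightarrow> real^'d::finite. (\<forall>i j. X i $ j \<in> {-1..1}) \<longrightarrow>
    (let A = values_on_data (network_class phi_out L V) X in
      enn2ereal (complexity M \<xi> A) \<le> psi_complexity lam M \<xi> A \<and>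
      psi_complexity lam M \<xi> A \<le>
        ereal (V * sqrt (2 * real CARD('n) * (real L * ln 2 + ln (2 * real CARD('d))))))"
proof -
  interpret prob_space M by fact
  interpret symmetric_subgaussian_noise M \<xi>
  proof
    show "indep_vars (\<lambda>_. borel) \<xi> UNIV" by fact
    show "distr M borel (\<lambda>\<omega>. - \<xi> i \<omega>) = distr M borel (\<xi> i)" for i
      using law by (auto intro: rademacher_symmetric std_normal_symmetric)
    show "(\<integral>\<^sup>+\<omega>. ennreal (exp (t * \<xi> i \<omega>)) \<partial>M) \<le> ennreal (exp (t\<^sup>2 / 2))" for t i
      using law by (auto intro: rademacher_subgaussian std_normal_subgaussian)
  qed
  define n where "n = real CARD('n)"
  define K where "K = real L * ln 2 + ln (2 * real CARD('d))"
  \<comment> \<open>With \<open>s = lam * V\<close> the bound reads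
    \<open>V * (K / s + s * n / 2)\<close>; it is smallest where the two summands agree, that is at
    \<open>s\<^sup>2 = 2 * K / n\<close>.\<close>
  define s where "s = sqrt (2 * K / n)"
  define lam where "lam = s / V"
  have n: "0 < n" by (simp add: n_def)
  have d: "1 \<le> real CARD('d)" by (simp add: Suc_leI)
  \<comment> \<open>Since \<open>d \<ge> 1\<close>, this makes \<open>K\<close> and therefore
    \<open>lam\<close> strictly positive.\<close>
  have "0 < ln (2 * real CARD('d))" by (rule ln_gt_zero) (use d in linarith)
  then have K: "0 < K" unfolding K_def by (intro add_nonneg_pos mult_nonneg_nonneg) auto
  have s: "0 < s" "s\<^sup>2 = 2 * K / n" using n K by (simp_all add: s_def)
  have lam: "0 < lam" "lam * V = s" using s \<open>V > 0\<close> by (simp_all add: lam_def)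
  have Ks: "K = s\<^sup>2 * n / 2" using n s by simp
  have "sqrt (2 * n * K) = sqrt ((n * s)\<^sup>2)"
    by (simp add: Ks power2_eq_square mult_ac)
  then have root: "sqrt (2 * n * K) = n * s" using n s by simp
  have bound_value: "(K + (lam * V)\<^sup>2 * n / 2) / lam = V * sqrt (2 * n * K)"
    unfolding root lam(2) using Ks s \<open>V > 0\<close> by (simp add: lam_def power2_eq_square field_simps)
  show ?thesis
  proof (intro exI[of _ lam] conjI allI impI lam)
    fix X :: "'n \<Rightarrow> real^'d"
    assume X: "\<forall>i j. X i $ j \<in> {-1..1}"
    let ?A = "values_on_data (network_class phi_out L V) X"
    have "?A \<noteq> {}" by (simp add: values_on_data_def network_class_def layers_nonempty)
    then have "enn2ereal (complexity M \<xi> ?A) \<le> psi_complexity lam M \<xi> ?A"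
      by (rule complexity_le_psi_complexity) (rule lam)
    moreover have "psi_complexity lam M \<xi> ?A \<le> ereal ((K + (lam * V)\<^sup>2 * n / 2) / lam)"
      unfolding K_def n_def using X by (intro psi_complexity_network_le lam lipschitz phi_out_zero) auto
    ultimately show "let A = ?A in enn2ereal (complexity M \<xi> A) \<le> psi_complexity lam M \<xi> A \<and>
        psi_complexity lam M \<xi> A \<le>
          ereal (V * sqrt (2 * real CARD('n) * (real L * ln 2 + ln (2 * real CARD('d)))))"
      unfolding bound_value Let_def by (simp add: K_def n_def)
  qed
qed

end
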